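(* Let $I$ be a closed ideal of a Dedekind $\sigma$-complete Fréchet lattice $(E,\tau)$. If two out of the following three conditions hold: (i) $E$ has the $(w_\tau,\tau)$-PSP; (ii) $I$ has the $(w_\tau,\tau)$-PSP; (iii) $E/I$ has the $(\dot w_\tau,\dot\tau)$-PSP; then the third condition holds too. Likewise, if two out of the following three conditions hold: (i') $E$ has the $(w_\tau,\tau)$-SP; (ii') $I$ has the $(w_\tau,\tau)$-SP; (iii') $E/I$ has the $(\dot w_\tau,\dot\tau)$-SP; then the third condition holds too.
   Context: A Fréchet lattice is a Riesz space endowed with a locally convex-solid (hence linear), metrizable and complete topology; a locally convex topology on a Riesz space is locally convex-solid if it is generated by a family of Riesz seminorms. Given linear topologies $\tau_1,\tau_2$ on a Riesz space $E$: $E$ has the $(\tau_1,\tau_2)$-Schur property, $(\tau_1,\tau_2)$-SP, if $\tau_1$-null sequences in $E$ are $\tau_2$-null; $E$ has the $(\tau_1,\tau_2)$-positive Schur property, $(\tau_1,\tau_2)$-PSP, if $\tau_1$-null sequences in $E$ formed by positive elements (i.e. $x_n\ge 0$) are $\tau_2$-null. $w_\tau$ denotes the weak topology on $E$ with respect to $\tau$ (induced by the $\tau$-continuous linear functionals). Riesz subspaces of $E$ (in particular ideals) carry the relative topologies, still denoted $\tau$ and $w_\tau$. For an ideal $I$ of $E$, $E/I$ is the quotient Riesz space, ordered by $\dot x\le\dot y$ if there are $x_1\in\dot x$, $y_1\in\dot y$ with $x_1\le y_1$. $\dot\tau$ and $\dot w_\tau$ denote the quotient topologies on $E/I$ associated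 to $\tau$ and $w_\tau$ respectively (the finest topology making the quotient map $E\to E/I$ continuous when $E$ carries $\tau$, respectively $w_\tau$); $\dot w_\tau$ coincides with the weak topology of $(E/I,\dot\tau)$. *)

theory Defs
  imports "HOL-Analysis.Analysis" "HOL-Library.Lattice_Algebras"
begin

text \<open>
  Topologies are explicit values of type \<^typ>\<open>'a topology\<close>, because several of them live on the
  same space. A Riesz space is a type; the modulus is the one of Lattice_Algebras,
  \<^prop>\<open>\<bar>x\<bar> = sup x (- x)\<close>.
\<close>

class riesz_space = ordered_real_vector + lattice_ab_group_add_abs

definition dedekind_sigma_complete :: "'a::riesz_space itself \<Rightarrow> bool" where
  "dedekind_sigma_complete _ \<longleftrightarrow>
     (\<forall>A::'a set. countable A \<and> A \<noteq> {} \<and> (\<exists>u. \<forall>a\<in>A. a \<le> u) \<longrightarrow>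
        (\<exists>s. (\<forall>a\<in>A. a \<le> s) \<and> (\<forall>u. (\<forall>a\<in>A. a \<le> u) \<longrightarrow> s \<le> u)))"

definition riesz_seminorm :: "('a::riesz_space \<Rightarrow> real) \<Rightarrow> bool" where
  "riesz_seminorm p \<longleftrightarrow>
     (\<forall>x y. p (x + y) \<le> p x + p y) \<and>
     (\<forall>c x. p (c *\<^sub>R x) = \<bar>c\<bar> * p x) \<and>
     (\<forall>x y. \<bar>x\<bar> \<le> \<bar>y\<bar> \<longrightarrow> p x \<le> p y)"

text \<open>The whole space is inserted so that the empty family generates the indiscrete topology
  rather than one with empty underlying set.\<close>

definition seminorm_topology :: "('a::real_vector \<Rightarrow> real) set \<Rightarrow> 'a topology" where
  "seminorm_topology P =
     topology_generated_by (insert UNIV {{x. p (x - a) < e} | p a e. p \<in> P \<and> 0 < e})"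

definition locally_convex_solid :: "'a::riesz_space topology \<Rightarrow> bool" where
  "locally_convex_solid \<tau> \<longleftrightarrow> (\<exists>P. (\<forall>p\<in>P. riesz_seminorm p) \<and> \<tau> = seminorm_topology P)"

text \<open>Completeness for the translation-invariant uniformity of a linear topology: every Cauchy
  filter converges.\<close>

definition complete_linear_topology :: "'a::real_vector topology \<Rightarrow> bool" where
  "complete_linear_topology \<tau> \<longleftrightarrow>
     (\<forall>F. F \<noteq> bot \<and>
        (\<forall>U. openin \<tau> U \<and> 0 \<in> U \<longrightarrow>
           (\<exists>A. eventually (\<lambda>x. x \<in> A) F \<and> (\<forall>x\<in>A. \<forall>y\<in>A. x - y \<in> U))) \<longrightarrow>
        (\<exists>l. limitin \<tau> (\<lambda>x. x) l F))"

definition frechet_lattice :: "'a::riesz_space topology \<Rightarrow> bool" where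
  "frechet_lattice \<tau> \<longleftrightarrow>
     locally_convex_solid \<tau> \<and> metrizable_space \<tau> \<and> complete_linear_topology \<tau>"

definition weak_topology :: "'a::real_vector topology \<Rightarrow> 'a topology" where
  "weak_topology \<tau> =
     topology_generated_by
       {f -` U | f U. linear f \<and> continuous_map \<tau> euclideanreal f \<and> open (U :: real set)}"

definition riesz_ideal :: "'a::riesz_space set \<Rightarrow> bool" where
  "riesz_ideal I \<longleftrightarrow> subspace I \<and> (\<forall>x y. y \<in> I \<and> \<bar>x\<bar> \<le> \<bar>y\<bar> \<longrightarrow> x \<in> I)"

text \<open>
  The elements of the quotient \<open>E/I\<close> are the cosets of \<open>I\<close>, so \<open>E/I\<close> is \<^term>\<open>range (coset I)\<close>,
  with zero element \<^term>\<open>coset I 0\<close> and quotient map \<^term>\<open>coset I\<close>.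
\<close>

definition coset :: "'a::real_vector set \<Rightarrow> 'a \<Rightarrow> 'a set" where
  "coset I x = {y. y - x \<in> I}"

definition coset_le :: "'a::order set \<Rightarrow> 'a set \<Rightarrow> bool" where
  "coset_le X Y \<longleftrightarrow> (\<exists>x\<in>X. \<exists>y\<in>Y. x \<le> y)"

definition quotient_topology :: "'a topology \<Rightarrow> ('a \<Rightarrow> 'b) \<Rightarrow> 'b topology" where
  "quotient_topology X f =
     topology (\<lambda>V. V \<subseteq> f ` topspace X \<and> openin X {x \<in> topspace X. f x \<in> V})"

text \<open>
  The Schur properties refer to a space only through its set \<open>E\<close> of elements, its zero element
  and (for the positive one) its order; these are parameters, so that the same definitions apply
  to the whole space, to an ideal and to a quotient.
\<close>

definition schur_property :: "'b set \<Rightarrow> 'b \<Rightarrow> 'b topology \<Rightarrow> 'b topology \<Rightarrow> bool" where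
  "schur_property E z \<tau>1 \<tau>2 \<longleftrightarrow>
     (\<forall>x :: nat \<Rightarrow> 'b. (\<forall>n. x n \<in> E) \<and> limitin \<tau>1 x z sequentially \<longrightarrow>
        limitin \<tau>2 x z sequentially)"

definition positive_schur_property ::
  "'b set \<Rightarrow> 'b \<Rightarrow> ('b \<Rightarrow> 'b \<Rightarrow> bool) \<Rightarrow> 'b topology \<Rightarrow> 'b topology \<Rightarrow> bool" where
  "positive_schur_property E z le \<tau>1 \<tau>2 \<longleftrightarrow>
     (\<forall>x :: nat \<Rightarrow> 'b. (\<forall>n. x n \<in> E \<and> le z (x n)) \<and> limitin \<tau>1 x z sequentially \<longrightarrow>
        limitin \<tau>2 x z sequentially)"

lemma openin_quotient_topology:
  "openin (quotient_topology X f) V \<longleftrightarrow>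
     V \<subseteq> f ` topspace X \<and> openin X {x \<in> topspace X. f x \<in> V}"
proof -
  have "istopology (\<lambda>V. V \<subseteq> f ` topspace X \<and> openin X {x \<in> topspace X. f x \<in> V})"
    unfolding istopology_def
  proof (intro conjI allI impI)
    fix S T
    assume S: "S \<subseteq> f ` topspace X \<and> openin X {x \<in> topspace X. f x \<in> S}"
      and T: "T \<subseteq> f ` topspace X \<and> openin X {x \<in> topspace X. f x \<in> T}"
    show "S \<inter> T \<subseteq> f ` topspace X" using S by blast
    have "{x \<in> topspace X. f x \<in> S \<inter> T} =
        {x \<in> topspace X. f x \<in> S} \<inter> {x \<in> topspace X. f x \<in> T}" by blast
    then show "openin X {x \<in> topspace X. f x \<in> S \<inter> T}" using S T by auto
  next
    fix K
    assume K: "\<forall>S\<in>K. S \<subseteq> f ` topspace X \<and> openin X {x \<in> topspace X. f x \<in> S}"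
    show "\<Union> K \<subseteq> f ` topspace X" using K by blast
    have "{x \<in> topspace X. f x \<in> \<Union> K} = (\<Union>S\<in>K. {x \<in> topspace X. f x \<in> S})" by blast
    then show "openin X {x \<in> topspace X. f x \<in> \<Union> K}" using K by auto
  qed
  then show ?thesis by (simp add: quotient_topology_def topology_inverse')
qed

lemma topspace_quotient_topology [simp]:
  "topspace (quotient_topology X f) = f ` topspace X"
proof -
  have "{x \<in> topspace X. f x \<in> f ` topspace X} = topspace X" by blast
  then have "openin (quotient_topology X f) (f ` topspace X)"
    by (simp add: openin_quotient_topology)
  then show ?thesis
    by (metis openin_quotient_topology openin_subset openin_topspace subset_antisym)
qed

lemma quotient_map_quotient_topology: "quotient_map X (quotient_topology X f) f"
  by (auto simp: quotient_map_def openin_quotient_topology)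

lemma topspace_seminorm_topology [simp]: "topspace (seminorm_topology P) = UNIV"
  by (simp add: seminorm_topology_def)

lemma topspace_weak_topology [simp]: "topspace (weak_topology \<tau>) = UNIV"
proof -
  have "UNIV \<in> {f -` U | f U. linear f \<and> continuous_map \<tau> euclideanreal f \<and> open (U :: real set)}"
    by (auto intro!: exI[of _ "\<lambda>_. 0"] exI[of _ "UNIV :: real set"] simp: linear_iff)
  then show ?thesis by (auto simp: weak_topology_def)
qed

end

theory Submission
  imports Defs
begin

text \<open>
  The passages from \<open>E\<close> to \<open>I\<close> are restrictions of sequences. For the passages from \<open>I\<close> and
  \<open>E/I\<close> to \<open>E\<close>, a weakly null sequence \<open>x\<^sub>n\<close> is null modulo \<open>I\<close>, hence \<open>x\<^sub>n = y\<^sub>n + z\<^sub>n\<close> with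
  \<open>y\<^sub>n \<in> I\<close> and \<open>z\<^sub>n\<close> null, so that \<open>y\<^sub>n\<close> is weakly null. If \<open>x\<^sub>n \<ge> 0\<close> one can arrange \<open>0 \<le> y\<^sub>n \<le> x\<^sub>n\<close>, and
  \<open>y\<^sub>n\<close> is weakly null because continuous functionals are differences of positive ones.

  The remaining passage, from \<open>E\<close> to \<open>E/I\<close>, rests on \<open>I\<close> being a projection band: if \<open>E\<close> has the
  positive Schur property, then order bounded increasing nets are Cauchy, hence converge. The
  projection onto the disjoint complement of \<open>I\<close> then lifts weakly null sequences of \<open>E/I\<close> to weakly
  null sequences of \<open>E\<close>, preserving positivity.
\<close>

section \<open>Seminorm topologies and weak topologies\<close>

text \<open>The sets that \<open>x\<close> eventually enters are stable under finite intersections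
  and under enlargement, so testing the subbasis suffices. The assumption says that \<open>l\<close>
  is a point of the space.\<close>

lemma limitin_topology_generated_by:
  assumes "l \<in> \<Union>S"
  shows "limitin (topology_generated_by S) x l F \<longleftrightarrow>
    (\<forall>U\<in>S. l \<in> U \<longrightarrow> eventually (\<lambda>n. x n \<in> U) F)"
proof
  assume "limitin (topology_generated_by S) x l F"
  then show "\<forall>U\<in>S. l \<in> U \<longrightarrow> eventually (\<lambda>n. x n \<in> U) F"
    by (auto simp: limitin_def topology_generated_by_Basis)
next
  assume *: "\<forall>U\<in>S. l \<in> U \<longrightarrow> eventually (\<lambda>n. x n \<in> U) F"
  have "l \<in> U \<longrightarrow> eventually (\<lambda>n. x n \<in> U) F" if "generate_topology_on S U" for U
    using that
  proof induction
    case (Int a b)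
    then show ?case by (auto intro: eventually_conj)
  next
    case (UN K)
    then show ?case by (fastforce elim: eventually_mono)
  qed (use * in auto)
  then show "limitin (topology_generated_by S) x l F"
    using assms by (simp add: limitin_def openin_topology_generated_by_iff)
qed

section \<open>Riesz seminorms and the topologies they generate\<close>

lemma riesz_seminormD:
  assumes "riesz_seminorm p"
  shows "p (x + y) \<le> p x + p y" "p (c *\<^sub>R x) = \<bar>c\<bar> * p x"
    "\<bar>x\<bar> \<le> \<bar>y\<bar> \<Longrightarrow> p x \<le> p y"
  using assms by (auto simp: riesz_seminorm_def)

lemma riesz_seminorm_zero [simp]: "riesz_seminorm p \<Longrightarrow> p 0 = 0"
  using riesz_seminormD(2)[of p 0 0] by simp

lemma riesz_seminorm_nonneg: "riesz_seminorm p \<Longrightarrow> 0 \<le> p x"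
  using riesz_seminormD(3)[of p 0 x] by simp

lemma riesz_seminorm_minus: "riesz_seminorm p \<Longrightarrow> p (- x) = p x"
  using riesz_seminormD(2)[of p "-1" x] by simp

lemma riesz_seminorm_diff_commute: "riesz_seminorm p \<Longrightarrow> p (x - y) = p (y - x)"
  using riesz_seminorm_minus[of p "x - y"] by simp

lemma riesz_seminorm_triangle_diff:
  "riesz_seminorm p \<Longrightarrow> p (x - z) \<le> p (x - y) + p (y - z)"
  using riesz_seminormD(1)[of p "x - y" "y - z"] by simp

text \<open>The subbasic balls may be centred anywhere. The triangle inequality recentres them at
  \<open>a\<close>, and finite intersections cost only finitely many seminorms and a smaller
  radius.\<close>

lemma openin_seminorm_topologyD:
  assumes P: "\<forall>p\<in>P. riesz_seminorm p"
    and U: "openin (seminorm_topology P) U" "a \<in> U"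
  obtains Q e where "finite Q" "Q \<subseteq> P" "0 < e" "{x. \<forall>p\<in>Q. p (x - a) < e} \<subseteq> U"
proof -
  define S where "S = insert UNIV {{x. p (x - a) < e} | p a e. p \<in> P \<and> 0 < e}"
  have "generate_topology_on S U"
    using U(1) by (simp add: seminorm_topology_def openin_topology_generated_by_iff S_def)
  then have "a \<in> U \<longrightarrow>
      (\<exists>Q e. finite Q \<and> Q \<subseteq> P \<and> 0 < e \<and> {x. \<forall>p\<in>Q. p (x - a) < e} \<subseteq> U)"
  proof induction
    case (Int A B)
    show ?case
    proof
      assume "a \<in> A \<inter> B"
      then obtain Q1 e1 Q2 e2 where
        "finite Q1" "Q1 \<subseteq> P" "0 < e1" "{x. \<forall>p\<in>Q1. p (x - a) < e1} \<subseteq> A"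
        "finite Q2" "Q2 \<subseteq> P" "0 < e2" "{x. \<forall>p\<in>Q2. p (x - a) < e2} \<subseteq> B"
        using Int.IH by blast
      then show "\<exists>Q e. finite Q \<and> Q \<subseteq> P \<and> 0 < e \<and> {x. \<forall>p\<in>Q. p (x - a) < e} \<subseteq> A \<inter> B"
        by (intro exI[of _ "Q1 \<union> Q2"] exI[of _ "min e1 e2"]) auto
    qed
  next
    case (UN K)
    show ?case
    proof
      assume "a \<in> \<Union>K"
      then obtain k where "k \<in> K" "a \<in> k" by blast
      with UN.IH[of k] show "\<exists>Q e. finite Q \<and> Q \<subseteq> P \<and> 0 < e \<and> {x. \<forall>p\<in>Q. p (x - a) < e} \<subseteq> \<Union>K"
        by blast
    qed
  next
    case (Basis s)
    show ?case
    proof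
      assume a: "a \<in> s"
      show "\<exists>Q e. finite Q \<and> Q \<subseteq> P \<and> 0 < e \<and> {x. \<forall>p\<in>Q. p (x - a) < e} \<subseteq> s"
      proof (cases "s = UNIV")
        case True
        then show ?thesis by (intro exI[of _ "{}"] exI[of _ 1]) auto
      next
        case False
        then obtain p b e where p: "p \<in> P" "0 < e" "s = {x. p (x - b) < e}"
          using Basis by (auto simp: S_def)
        \<comment> \<open>Since \<open>a\<close> lies in the ball of radius \<open>e\<close> about
          \<open>b\<close>, the number \<open>e - p (a - b)\<close> is positive; it is the radius
          left around \<open>a\<close>.\<close>
        have "{x. p (x - a) < e - p (a - b)} \<subseteq> s"
          using riesz_seminorm_triangle_diff[OF P[rule_format, OF p(1)], of _ b a] p(3)
          by (force simp: less_diff_eq intro: order.strict_trans1)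
        then show ?thesis
          using p a by (intro exI[of _ "{p}"] exI[of _ "e - p (a - b)"]) auto
      qed
    qed
  qed simp
  with U(2) that show thesis by blast
qed

lemma limitin_seminorm_topology:
  assumes P: "\<forall>p\<in>P. riesz_seminorm p"
  shows "limitin (seminorm_topology P) x l F \<longleftrightarrow> (\<forall>p\<in>P. ((\<lambda>n. p (x n - l)) \<longlongrightarrow> 0) F)"
proof
  assume L: "limitin (seminorm_topology P) x l F"
  show "\<forall>p\<in>P. ((\<lambda>n. p (x n - l)) \<longlongrightarrow> 0) F"
  proof (intro ballI tendstoI)
    fix p e assume p: "p \<in> P" and e: "0 < (e::real)"
    have "openin (seminorm_topology P) {x. p (x - l) < e}"
      unfolding seminorm_topology_def using p e by (intro topology_generated_by_Basis) blast
    with L P[rule_format, OF p] e have "eventually (\<lambda>n. p (x n - l) < e) F"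
      by (auto simp: limitin_def)
    then show "eventually (\<lambda>n. dist (p (x n - l)) 0 < e) F"
      using riesz_seminorm_nonneg[OF P[rule_format, OF p]] by (simp add: dist_norm)
  qed
next
  assume R: "\<forall>p\<in>P. ((\<lambda>n. p (x n - l)) \<longlongrightarrow> 0) F"
  show "limitin (seminorm_topology P) x l F"
    unfolding limitin_def
  proof (intro conjI allI impI)
    fix U assume "openin (seminorm_topology P) U \<and> l \<in> U"
    then have U: "openin (seminorm_topology P) U" "l \<in> U" by auto
    obtain Q e where Q: "finite Q" "Q \<subseteq> P" "0 < e" "{x. \<forall>p\<in>Q. p (x - l) < e} \<subseteq> U"
      by (rule openin_seminorm_topologyD[OF P U])
    have "\<forall>p\<in>Q. eventually (\<lambda>n. p (x n - l) < e) F"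
    proof
      fix p assume "p \<in> Q"
      then have "((\<lambda>n. p (x n - l)) \<longlongrightarrow> 0) F" using R Q(2) by blast
      then show "eventually (\<lambda>n. p (x n - l) < e) F" using Q(3) by (rule order_tendstoD(2))
    qed
    then have "eventually (\<lambda>n. \<forall>p\<in>Q. p (x n - l) < e) F"
      using Q(1) by (simp add: eventually_ball_finite)
    then show "eventually (\<lambda>n. x n \<in> U) F"
      using Q(4) by (auto elim: eventually_mono)
  qed simp
qed

text \<open>Riesz seminorms are monotone in the modulus, so the values at \<open>y n\<close> are
  squeezed.\<close>

lemma limitin_seminorm_topology_dominated:
  assumes P: "\<forall>p\<in>P. riesz_seminorm p"
    and x: "limitin (seminorm_topology P) x 0 F"
    and le: "\<And>n. \<bar>y n\<bar> \<le> \<bar>x n\<bar>"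
  shows "limitin (seminorm_topology P) y 0 F"
  unfolding limitin_seminorm_topology[OF P]
proof
  fix p assume p: "p \<in> P"
  show "((\<lambda>n. p (y n - 0)) \<longlongrightarrow> 0) F"
  proof (rule tendsto_sandwich[where f = "\<lambda>_. 0" and h = "\<lambda>n. p (x n)"])
    show "((\<lambda>n. p (x n)) \<longlongrightarrow> 0) F"
      using x p by (simp add: limitin_seminorm_topology[OF P])
  qed (use le P[rule_format, OF p] in \<open>auto simp: riesz_seminorm_nonneg riesz_seminormD(3)\<close>)
qed

lemma limitin_seminorm_topology_add:
  assumes P: "\<forall>p\<in>P. riesz_seminorm p"
    and x: "limitin (seminorm_topology P) x 0 F" and y: "limitin (seminorm_topology P) y 0 F"
  shows "limitin (seminorm_topology P) (\<lambda>n. x n + y n) 0 F"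
  unfolding limitin_seminorm_topology[OF P]
proof
  fix p assume p: "p \<in> P"
  then have r: "riesz_seminorm p" using P by blast
  have "((\<lambda>n. p (x n - 0) + p (y n - 0)) \<longlongrightarrow> 0 + 0) F"
    using bspec[OF x[unfolded limitin_seminorm_topology[OF P]] p]
      bspec[OF y[unfolded limitin_seminorm_topology[OF P]] p] by (rule tendsto_add)
  then have lim: "((\<lambda>n. p (x n) + p (y n)) \<longlongrightarrow> 0) F" by simp
  show "((\<lambda>n. p (x n + y n - 0)) \<longlongrightarrow> 0) F"
    by (rule tendsto_sandwich[OF _ _ tendsto_const lim])
      (use r in \<open>simp_all add: riesz_seminorm_nonneg riesz_seminormD(1)\<close>)
qed

lemma riesz_seminorm_sum:
  assumes "\<And>p. p \<in> Q \<Longrightarrow> riesz_seminorm p"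
  shows "riesz_seminorm (\<lambda>x. \<Sum>p\<in>Q. p x)"
  unfolding riesz_seminorm_def
  using assms by (auto simp: riesz_seminormD sum_distrib_left simp flip: sum.distrib intro!: sum_mono)

text \<open>Continuity keeps \<open>f\<close> within \<open>{-1<..<1}\<close> on a seminorm ball
  around 0, and homogeneity turns this into a global bound. A sum over \<open>Q\<close> is again a
  Riesz seminorm.\<close>

lemma continuous_linear_seminorm_bound:
  assumes P: "\<forall>p\<in>P. riesz_seminorm p"
    and f: "linear f" "continuous_map (seminorm_topology P) euclideanreal f"
  obtains Q C where "finite Q" "Q \<subseteq> P" "0 \<le> C" "\<And>x. \<bar>f x\<bar> \<le> C * (\<Sum>p\<in>Q. p x)"
proof -
  interpret linear f by fact
  have "openin (seminorm_topology P) {x \<in> topspace (seminorm_topology P). f x \<in> {-1<..<1}}"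
    by (rule openin_continuous_map_preimage[OF f(2)]) simp
  then have o: "openin (seminorm_topology P) {x. f x \<in> {-1<..<1}}" by simp
  obtain Q e where Q: "finite Q" "Q \<subseteq> P" "0 < e" "{x. \<forall>p\<in>Q. p (x - 0) < e} \<subseteq> {x. f x \<in> {-1<..<1}}"
    by (rule openin_seminorm_topologyD[OF P o, of 0]) (auto simp: zero)
  have "\<bar>f x\<bar> \<le> 1 / e * (\<Sum>p\<in>Q. p x)" for x
  proof (rule field_le_epsilon)
    fix d :: real assume d: "0 < d"
    \<comment> \<open>The term \<open>e * d\<close> makes \<open>s\<close> exceed every
      \<open>p x\<close> strictly and stay positive even if all of them vanish, so division by
      \<open>s\<close> is legitimate; \<open>d\<close> is arbitrary.\<close>
    define s where "s = (\<Sum>p\<in>Q. p x) + e * d"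
    have nn: "0 \<le> p x" if "p \<in> Q" for p using P Q(2) that riesz_seminorm_nonneg by blast
    then have s0: "0 < s" using d Q(3) by (simp add: s_def add_nonneg_pos sum_nonneg)
    have s: "p x < s" if "p \<in> Q" for p
    proof -
      have "p x \<le> (\<Sum>p\<in>Q. p x)"
        using that nn Q(1) by (auto intro!: member_le_sum sum_nonneg)
      moreover have "0 < e * d" using d Q(3) by simp
      ultimately show "p x < s" by (simp add: s_def)
    qed
    have "p ((e / s) *\<^sub>R x) < e" if "p \<in> Q" for p
    proof -
      have "p ((e / s) *\<^sub>R x) = e / s * p x"
        using riesz_seminormD(2)[of p "e / s" x] P that Q(2,3) s0 by auto
      also have "\<dots> < e" using s[of p] that Q(3) s0 by (simp add: field_simps)
      finally show ?thesis .
    qed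
    then have "\<bar>f ((e / s) *\<^sub>R x)\<bar> < 1" using Q(4) by (auto simp: abs_less_iff)
    then have "\<bar>f x\<bar> < s / e" using Q(3) s0 by (simp add: scaleR abs_mult field_simps)
    also have "s / e = 1 / e * (\<Sum>p\<in>Q. p x) + d" using Q(3) by (simp add: s_def field_simps)
    finally show "\<bar>f x\<bar> \<le> 1 / e * (\<Sum>p\<in>Q. p x) + d" by simp
  qed
  with that[of Q "1 / e"] Q show thesis by simp
qed

text \<open>With this converse of the preceding bound, continuity of a positive part and of a
  functional composed with a projection becomes an estimate.\<close>

lemma continuous_linear_of_seminorm_bound:
  assumes P: "\<forall>p\<in>P. riesz_seminorm p"
    and f: "linear f" and Q: "finite Q" "Q \<subseteq> P" "\<And>x. \<bar>f x\<bar> \<le> C * (\<Sum>p\<in>Q. p x)"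
  shows "continuous_map (seminorm_topology P) euclideanreal f"
proof -
  interpret linear f by fact
  have "limitin euclideanreal f (f a) (atin (seminorm_topology P) a)" for a
  proof -
    have "limitin (seminorm_topology P) (\<lambda>x. x) a (atin (seminorm_topology P) a)"
      by (auto simp: limitin_def eventually_atin)
    then have "((\<lambda>x. p (x - a)) \<longlongrightarrow> 0) (atin (seminorm_topology P) a)" if "p \<in> Q" for p
      using that Q(2) by (auto simp: limitin_seminorm_topology[OF P])
    then have "((\<lambda>x. C * (\<Sum>p\<in>Q. p (x - a))) \<longlongrightarrow> C * (\<Sum>p\<in>Q. 0)) (atin (seminorm_topology P) a)"
      by (intro tendsto_mult_left tendsto_sum) auto
    then have lim: "((\<lambda>x. C * (\<Sum>p\<in>Q. p (x - a))) \<longlongrightarrow> 0) (atin (seminorm_topology P) a)" by simp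
    have "norm (f x - f a) \<le> C * (\<Sum>p\<in>Q. p (x - a))" for x
      using Q(3)[of "x - a"] by (simp add: diff)
    then have "((\<lambda>x. f x - f a) \<longlongrightarrow> 0) (atin (seminorm_topology P) a)"
      by (rule Lim_null_comparison[OF always_eventually[OF allI] lim])
    then show ?thesis by (simp only: limitin_canonical_iff flip: Lim_null)
  qed
  then show ?thesis by (auto simp: continuous_map_atin)
qed

section \<open>Weak convergence\<close>

lemma limitin_weak_topology:
  "limitin (weak_topology \<tau>) x l F \<longleftrightarrow>
     (\<forall>f. linear f \<and> continuous_map \<tau> euclideanreal f \<longrightarrow> ((\<lambda>n. f (x n)) \<longlongrightarrow> f l) F)"
proof -
  have "l \<in> \<Union>{f -` U | f U. linear f \<and> continuous_map \<tau> euclideanreal f \<and> open (U :: real set)}"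
    using topspace_weak_topology[of \<tau>]
    unfolding weak_topology_def topology_generated_by_topspace by (simp only: UNIV_I)
  then have "limitin (weak_topology \<tau>) x l F \<longleftrightarrow>
      (\<forall>V\<in>{f -` U | f U. linear f \<and> continuous_map \<tau> euclideanreal f \<and> open (U :: real set)}.
        l \<in> V \<longrightarrow> eventually (\<lambda>n. x n \<in> V) F)"
    unfolding weak_topology_def by (rule limitin_topology_generated_by)
  also have "\<dots> \<longleftrightarrow> (\<forall>f U. linear f \<and> continuous_map \<tau> euclideanreal f \<and> open U \<longrightarrow>
      l \<in> f -` U \<longrightarrow> eventually (\<lambda>n. x n \<in> f -` U) F)"
    by blast
  finally show ?thesis unfolding tendsto_def vimage_eq by blast
qed

lemma limitin_imp_limitin_weak_topology:
  assumes "limitin \<tau> x l F" shows "limitin (weak_topology \<tau>) x l F"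
  unfolding limitin_weak_topology
  using continuous_map_limit[OF _ assms, of euclideanreal] by (auto simp: o_def)

lemma limitin_weak_topology_diff:
  assumes "limitin (weak_topology \<tau>) x l F" "limitin (weak_topology \<tau>) y m F"
  shows "limitin (weak_topology \<tau>) (\<lambda>n. x n - y n) (l - m) F"
  using assms by (auto simp: limitin_weak_topology linear_diff intro!: tendsto_diff)

section \<open>Positive functionals\<close>

text \<open>Note that \<open>nprt x = inf x 0 \<le> 0\<close>, so the negative part \<open>x\<^sup>-\<close> is \<open>- nprt x\<close>.\<close>

lemma linear_extension_of_cone:
  fixes g :: "'a::riesz_space \<Rightarrow> real"
  assumes add: "\<And>x y. 0 \<le> x \<Longrightarrow> 0 \<le> y \<Longrightarrow> g (x + y) = g x + g y"
    and scale: "\<And>c x. 0 \<le> c \<Longrightarrow> 0 \<le> x \<Longrightarrow> g (c *\<^sub>R x) = c * g x"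
  shows "linear (\<lambda>x. g (pprt x) - g (- nprt x))" (is "linear ?F")
proof -
  \<comment> \<open>The value \<open>g a - g b\<close> depends only on \<open>a - b\<close>, so any
    convenient decomposition into nonnegative elements may replace the one by \<open>pprt\<close>
    and \<open>nprt\<close>.\<close>
  have F: "?F (a - b) = g a - g b" if "0 \<le> a" "0 \<le> b" for a b
  proof -
    have "pprt (a - b) + b = a + - nprt (a - b)"
      using prts[of "a - b"] by (simp add: algebra_simps)
    then have "g (pprt (a - b) + b) = g (a + - nprt (a - b))" by simp
    then show ?thesis using that by (simp add: add del: add_uminus_conv_diff)
  qed
  show ?thesis
  proof (rule linearI)
    fix x y :: 'a
    have "x + y = (pprt x + pprt y) - (- nprt x + - nprt y)"
      using arg_cong2[OF prts[of x] prts[of y], of "(+)"] by (simp add: algebra_simps)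
    then have "?F (x + y) = g (pprt x + pprt y) - g (- nprt x + - nprt y)"
      by (metis (no_types, lifting) F add_nonneg_nonneg neg_0_le_iff_le nprt_le_zero zero_le_pprt)
    then show "?F (x + y) = ?F x + ?F y"
      using add[of "- nprt x" "- nprt y"] by (simp add: add del: add_uminus_conv_diff)
  next
    fix c :: real and x :: 'a
    show "?F (c *\<^sub>R x) = c *\<^sub>R ?F x"
    proof (cases "0 \<le> c")
      case True
      have "c *\<^sub>R x = c *\<^sub>R pprt x - c *\<^sub>R (- nprt x)"
        using prts[of x] by (simp flip: scaleR_right_distrib)
      then have "?F (c *\<^sub>R x) = g (c *\<^sub>R pprt x) - g (c *\<^sub>R (- nprt x))"
        using True by (metis (no_types, lifting) F neg_0_le_iff_le nprt_le_zero scaleR_nonneg_nonneg zero_le_pprt)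
      then show ?thesis
        using True scale[of c "pprt x"] scale[of c "- nprt x"] by (simp add: algebra_simps)
    next
      case False
      \<comment> \<open>A negative scalar interchanges the positive and the negative part.\<close>
      have "c *\<^sub>R x = (- c) *\<^sub>R (- nprt x) - (- c) *\<^sub>R pprt x"
        using prts[of x] by (simp flip: scaleR_right_distrib add: add.commute)
      then have "?F (c *\<^sub>R x) = g ((- c) *\<^sub>R (- nprt x)) - g ((- c) *\<^sub>R pprt x)"
        using False
        by (metis (no_types, lifting) F linorder_le_cases neg_0_le_iff_le nprt_le_zero scaleR_nonneg_nonneg zero_le_pprt)
      then show ?thesis
        using False scale[of "- c" "pprt x"] scale[of "- c" "- nprt x"] by (simp add: algebra_simps)
    qed
  qed
qed

text \<open>The positive part is \<open>f\<^sup>+ x = sup {f z | 0 \<le> z \<le> x}\<close> for \<open>x \<ge> 0\<close>, additive by Riesz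
  decomposition.\<close>

lemma continuous_linear_positive_part:
  fixes f :: "'a::riesz_space \<Rightarrow> real"
  assumes P: "\<forall>p\<in>P. riesz_seminorm p"
    and f: "linear f" "continuous_map (seminorm_topology P) euclideanreal f"
  obtains h where "linear h" "continuous_map (seminorm_topology P) euclideanreal h"
    "\<And>x. 0 \<le> x \<Longrightarrow> 0 \<le> h x" "\<And>x. 0 \<le> x \<Longrightarrow> f x \<le> h x"
proof -
  interpret f: linear f by fact
  obtain Q C where Q: "finite Q" "Q \<subseteq> P" "0 \<le> C" "\<And>x. \<bar>f x\<bar> \<le> C * (\<Sum>p\<in>Q. p x)"
    using continuous_linear_seminorm_bound[OF P f] by blast
  \<comment> \<open>A bound for \<open>f\<close> that is monotone in the modulus: it makes the
    suprema in \<open>g\<close> finite and later bounds \<open>h\<close>, hence gives its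
    continuity.\<close>
  define q where "q x = C * (\<Sum>p\<in>Q. p x)" for x
  have rq: "riesz_seminorm (\<lambda>x. \<Sum>p\<in>Q. p x)"
    using P Q(2) by (intro riesz_seminorm_sum) auto
  have q_mono: "q x \<le> q y" if "\<bar>x\<bar> \<le> \<bar>y\<bar>" for x y
    unfolding q_def using riesz_seminormD(3)[OF rq that] Q(3) by (intro mult_left_mono)
  define g where "g x = (SUP z\<in>{0..x}. f z)" for x
  have f_le_q: "f z \<le> q x" if "z \<in> {0..x}" for x z
  proof -
    have "f z \<le> q z" using Q(4)[of z] by (simp add: q_def)
    also have "\<dots> \<le> q x" using that by (intro q_mono) (auto intro: order_trans)
    finally show ?thesis .
  qed
  have bdd: "bdd_above (f ` {0..x})" for x
    using f_le_q by (intro bdd_aboveI[of _ "q x"]) auto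
  have upper: "f z \<le> g x" if "0 \<le> z" "z \<le> x" for x z
    unfolding g_def using that by (intro cSUP_upper bdd) auto
  have least: "g x \<le> M" if "0 \<le> x" "\<And>z. 0 \<le> z \<Longrightarrow> z \<le> x \<Longrightarrow> f z \<le> M" for x M
    unfolding g_def using that by (intro cSUP_least) auto
  have add: "g (x + y) = g x + g y" if "0 \<le> x" "0 \<le> y" for x y
  proof (rule antisym)
    show "g (x + y) \<le> g x + g y"
    proof (rule least)
      fix z assume z: "0 \<le> z" "z \<le> x + y"
      \<comment> \<open>Riesz decomposition: \<open>z\<close> splits into \<open>inf z x\<close>,
        below \<open>x\<close>, and \<open>sup 0 (z - x)\<close>, below \<open>y\<close>.\<close>
      have "z - inf z x = sup 0 (z - x)" by (simp add: diff_inf_eq_sup add_sup_distrib_left)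
      then have "0 \<le> z - inf z x" "z - inf z x \<le> y" using z that by (auto simp: algebra_simps)
      then have "f (z - inf z x) \<le> g y" by (rule upper)
      moreover have "f (inf z x) \<le> g x" using z that by (intro upper) auto
      ultimately show "f z \<le> g x + g y" using f.diff[of z "inf z x"] by linarith
    qed (use that in simp)
    have "g x \<le> g (x + y) - g y"
    proof (rule least[OF that(1)])
      fix z assume z: "0 \<le> z" "z \<le> x"
      have "g y \<le> g (x + y) - f z"
      proof (rule least[OF that(2)])
        fix w assume w: "0 \<le> w" "w \<le> y"
        have "f (z + w) \<le> g (x + y)" using z w by (intro upper) (auto intro: add_mono)
        then show "f w \<le> g (x + y) - f z" by (simp add: f.add)
      qed
      then show "f z \<le> g (x + y) - g y" by simp
    qed
    then show "g x + g y \<le> g (x + y)" by simp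
  qed
  have scale_le: "g (c *\<^sub>R x) \<le> c * g x" if "0 < c" "0 \<le> x" for c x
  proof (rule least)
    fix z assume z: "0 \<le> z" "z \<le> c *\<^sub>R x"
    have "(1 / c) *\<^sub>R z \<le> (1 / c) *\<^sub>R (c *\<^sub>R x)" using z(2) that by (intro scaleR_left_mono) auto
    then have "f ((1 / c) *\<^sub>R z) \<le> g x" using z that by (intro upper scaleR_nonneg_nonneg) auto
    then show "f z \<le> c * g x" using that by (simp add: f.scaleR field_simps)
  next
    show "0 \<le> c *\<^sub>R x" using that by (intro scaleR_nonneg_nonneg) auto
  qed
  have g0: "g 0 = 0" using add[of 0 0] by simp
  have scale: "g (c *\<^sub>R x) = c * g x" if "0 \<le> c" "0 \<le> x" for c x
  proof (cases "c = 0")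
    case False
    then have c: "0 < c" using that by simp
    \<comment> \<open>The reverse inequality is \<open>scale_le\<close> with factor
      \<open>1 / c\<close> at the point \<open>c *\<^sub>R x\<close>.\<close>
    have "g ((1 / c) *\<^sub>R (c *\<^sub>R x)) \<le> 1 / c * g (c *\<^sub>R x)" using c that by (intro scale_le scaleR_nonneg_nonneg) auto
    then have "c * g x \<le> g (c *\<^sub>R x)" using c by (simp add: field_simps)
    with scale_le[OF c that(2)] show ?thesis by simp
  qed (simp add: g0)
  define h where "h x = g (pprt x) - g (- nprt x)" for x
  have h: "linear h" unfolding h_def by (rule linear_extension_of_cone[OF add scale])
  have hg: "h x = g x" if "0 \<le> x" for x using that by (simp add: h_def g0)
  have g_nonneg: "0 \<le> g x" if "0 \<le> x" for x using upper[of 0 x] that by simp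
  have g_le: "g x \<le> q x" if "0 \<le> x" for x using that by (intro least) (auto intro: f_le_q)
  have "\<bar>h x\<bar> \<le> C * (\<Sum>p\<in>Q. p x)" for x
  proof -
    have "\<bar>pprt x\<bar> \<le> \<bar>x\<bar>" "\<bar>- nprt x\<bar> \<le> \<bar>x\<bar>"
      unfolding abs_prts[of x] by (auto simp: algebra_simps)
    then have "g (pprt x) \<le> q x" "g (- nprt x) \<le> q x"
      using g_le[of "pprt x"] g_le[of "- nprt x"] q_mono[of "pprt x" x] q_mono[of "- nprt x" x] by auto
    then show ?thesis
      using g_nonneg[of "pprt x"] g_nonneg[of "- nprt x"] by (simp add: h_def q_def)
  qed
  then have "continuous_map (seminorm_topology P) euclideanreal h"
    by (rule continuous_linear_of_seminorm_bound[OF P h Q(1,2)])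
  with h show thesis
    by (rule that) (simp_all add: hg g_nonneg upper)
qed

text \<open>Write a continuous functional \<open>f\<close> as \<open>h - (h - f)\<close>, where
  \<open>h\<close> dominates both 0 and \<open>f\<close> on the positive cone; both terms are then
  positive and continuous.\<close>

lemma limitin_weak_topology_positive_functionals:
  fixes x :: "'b \<Rightarrow> 'a::riesz_space"
  assumes P: "\<forall>p\<in>P. riesz_seminorm p"
    and *: "\<And>h. linear h \<Longrightarrow> continuous_map (seminorm_topology P) euclideanreal h \<Longrightarrow>
      (\<And>x. 0 \<le> x \<Longrightarrow> 0 \<le> h x) \<Longrightarrow> ((\<lambda>n. h (x n)) \<longlongrightarrow> h l) F"
  shows "limitin (weak_topology (seminorm_topology P)) x l F"
  unfolding limitin_weak_topology
proof (intro allI impI)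
  fix f :: "'a \<Rightarrow> real"
  assume f: "linear f \<and> continuous_map (seminorm_topology P) euclideanreal f"
  then obtain h where h: "linear h" "continuous_map (seminorm_topology P) euclideanreal h"
    "\<And>x. 0 \<le> x \<Longrightarrow> 0 \<le> h x" "\<And>x. 0 \<le> x \<Longrightarrow> f x \<le> h x"
    using continuous_linear_positive_part[OF P, of f] by blast
  have "((\<lambda>n. h (x n) - f (x n)) \<longlongrightarrow> h l - f l) F"
    using f h by (intro *[of "\<lambda>x. h x - f x"] linear_compose_sub continuous_map_diff) auto
  moreover have "((\<lambda>n. h (x n)) \<longlongrightarrow> h l) F" using h by (intro *) auto
  ultimately have "((\<lambda>n. h (x n) - (h (x n) - f (x n))) \<longlongrightarrow> h l - (h l - f l)) F"
    by (rule tendsto_diff[rotated])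
  then show "((\<lambda>n. f (x n)) \<longlongrightarrow> f l) F" by simp
qed

text \<open>Positive functionals are monotone, so their values at \<open>y n\<close> lie between 0
  and their values at \<open>x n\<close>.\<close>

lemma weakly_null_dominated:
  fixes x y :: "'b \<Rightarrow> 'a::riesz_space"
  assumes P: "\<forall>p\<in>P. riesz_seminorm p"
    and x: "limitin (weak_topology (seminorm_topology P)) x 0 F"
    and y: "\<And>n. 0 \<le> y n" "\<And>n. y n \<le> x n"
  shows "limitin (weak_topology (seminorm_topology P)) y 0 F"
proof (rule limitin_weak_topology_positive_functionals[OF P])
  fix h :: "'a \<Rightarrow> real"
  assume h: "linear h" "continuous_map (seminorm_topology P) euclideanreal h"
    "\<And>x. 0 \<le> x \<Longrightarrow> 0 \<le> h x"
  have "((\<lambda>n. h (x n)) \<longlongrightarrow> 0) F"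
    using x h(1,2) by (auto simp: limitin_weak_topology linear_0)
  moreover have "h (y n) \<le> h (x n)" for n
    using h(3)[of "x n - y n"] y(2)[of n] by (simp add: linear_diff[OF h(1)])
  ultimately have "((\<lambda>n. h (y n)) \<longlongrightarrow> 0) F"
    using y(1) h(3) by (intro tendsto_sandwich[of "\<lambda>_. 0" "\<lambda>n. h (y n)" F "\<lambda>n. h (x n)"]) auto
  then show "((\<lambda>n. h (y n)) \<longlongrightarrow> h 0) F" by (simp add: linear_0[OF h(1)])
qed

text \<open>A positive functional \<open>h\<close> turns \<open>d\<close> into a nonnegative series
  with partial sums at most \<open>h x\<close>; the terms of a convergent series tend to 0.\<close>

lemma weakly_null_of_bounded_partial_sums:
  fixes d :: "nat \<Rightarrow> 'a::riesz_space"
  assumes P: "\<forall>p\<in>P. riesz_seminorm p"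
    and d: "\<And>n. 0 \<le> d n" "\<And>n. (\<Sum>k<n. d k) \<le> x"
  shows "limitin (weak_topology (seminorm_topology P)) d 0 sequentially"
proof (rule limitin_weak_topology_positive_functionals[OF P])
  fix h :: "'a \<Rightarrow> real"
  assume h: "linear h" "continuous_map (seminorm_topology P) euclideanreal h"
    "\<And>x. 0 \<le> x \<Longrightarrow> 0 \<le> h x"
  have "(\<Sum>k<n. h (d k)) \<le> h x" for n
    using h(3)[of "x - (\<Sum>k<n. d k)"] d(2)[of n] by (simp add: linear_diff[OF h(1)] linear_sum[OF h(1)])
  then have "summable (\<lambda>k. h (d k))"
    using h(3) d(1) by (intro summableI_nonneg_bounded) auto
  then have "(\<lambda>k. h (d k)) \<longlonglongrightarrow> 0" by (rule summable_LIMSEQ_zero)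
  then show "(\<lambda>k. h (d k)) \<longlonglongrightarrow> h 0" by (simp add: linear_0[OF h(1)])
qed

section \<open>The quotient topology\<close>

lemma coset_eq_iff:
  assumes "subspace I" shows "coset I x = coset I y \<longleftrightarrow> x - y \<in> I"
proof
  assume "coset I x = coset I y"
  moreover have "x \<in> coset I x" using assms by (simp add: coset_def subspace_0)
  ultimately show "x - y \<in> I" by (simp add: coset_def)
next
  assume *: "x - y \<in> I"
  have "z - x \<in> I \<longleftrightarrow> z - y \<in> I" for z
    using subspace_add[OF assms, of "z - x" "x - y"] subspace_diff[OF assms, of "z - y" "x - y"] *
    by auto
  then show "coset I x = coset I y" by (auto simp: coset_def)
qed

lemma limitin_quotient_coset:
  assumes "limitin T x l F"
  shows "limitin (quotient_topology T (coset I)) (\<lambda>n. coset I (x n)) (coset I l) F"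
  using continuous_map_limit[OF quotient_imp_continuous_map[OF quotient_map_quotient_topology] assms]
  by (simp add: o_def)

text \<open>A functional vanishing on \<open>I\<close> is constant on cosets. The preimage of a ball
  is therefore a union of cosets, and its image is open in the quotient.\<close>

lemma limitin_quotient_weak_topologyD:
  assumes I: "subspace I"
    and lim: "limitin (quotient_topology (weak_topology \<tau>) (coset I)) (\<lambda>n. coset I (v n)) (coset I 0) F"
    and g: "linear g" "continuous_map \<tau> euclideanreal g" "\<And>x. x \<in> I \<Longrightarrow> g x = 0"
  shows "((\<lambda>n. g (v n)) \<longlongrightarrow> 0) F"
proof (rule tendstoI)
  fix e :: real assume e: "0 < e"
  define W where "W = g -` ball 0 e"
  have sat: "coset I x \<in> coset I ` W \<longleftrightarrow> x \<in> W" for x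
  proof
    assume "coset I x \<in> coset I ` W"
    then obtain y where "x - y \<in> I" "y \<in> W" using coset_eq_iff[OF I] by auto
    then show "x \<in> W" using g(3)[of "x - y"] by (simp add: W_def linear_diff[OF g(1)])
  qed auto
  have "openin (weak_topology \<tau>) W"
    unfolding weak_topology_def W_def using g by (intro topology_generated_by_Basis) blast
  then have "openin (quotient_topology (weak_topology \<tau>) (coset I)) (coset I ` W)"
    by (auto simp: openin_quotient_topology sat)
  moreover have "0 \<in> W" using e by (simp add: W_def linear_0[OF g(1)])
  ultimately have "eventually (\<lambda>n. coset I (v n) \<in> coset I ` W) F"
    using lim by (auto simp: limitin_def)
  then show "eventually (\<lambda>n. dist (g (v n)) 0 < e) F"
    unfolding sat by (simp add: W_def)
qed

section \<open>Openness of the quotient map and lifting of null sequences\<close>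

lemma openin_seminorm_topology_translation:
  assumes "openin (seminorm_topology P) U"
  shows "openin (seminorm_topology P) {x. x - a \<in> U}"
proof -
  define S where "S = insert UNIV {{x. p (x - a) < e} | p a e. p \<in> P \<and> 0 < e}"
  have "generate_topology_on S U"
    using assms by (simp add: seminorm_topology_def openin_topology_generated_by_iff S_def)
  then have "openin (topology_generated_by S) {x. x - a \<in> U}"
  proof induction
    case (Int A B)
    then show ?case using openin_Int by (fastforce simp: Collect_conj_eq)
  next
    case (UN K)
    have "{x. x - a \<in> \<Union>K} = (\<Union>k\<in>K. {x. x - a \<in> k})" by auto
    then show ?case using UN by auto
  next
    case (Basis s)
    show ?case
    proof (rule topology_generated_by_Basis)
      show "{x. x - a \<in> s} \<in> S"
      proof (cases "s = UNIV")
        case False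
        then obtain p b e where p: "p \<in> P" "0 < e" "s = {x. p (x - b) < e}"
          using Basis by (auto simp: S_def)
        have "{x. x - a \<in> s} = {x. p (x - (a + b)) < e}" by (simp add: p(3) algebra_simps)
        then show ?thesis using p(1,2) unfolding S_def by blast
      qed (simp add: S_def)
    qed
  qed simp
  then show ?thesis by (simp add: seminorm_topology_def S_def)
qed

text \<open>The saturation of \<open>U\<close> is the union of its translates by elements of
  \<open>I\<close>, and these are open.\<close>

lemma openin_quotient_coset_image:
  assumes I: "subspace I" and U: "openin (seminorm_topology P) U"
  shows "openin (quotient_topology (seminorm_topology P) (coset I)) (coset I ` U)"
proof -
  have "{x. coset I x \<in> coset I ` U} = (\<Union>i\<in>I. {x. x - i \<in> U})" (is "?L = ?R")
  proof (intro set_eqI iffI)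
    fix x assume "x \<in> ?L"
    then obtain u where "u \<in> U" "x - u \<in> I" using coset_eq_iff[OF I] by auto
    then show "x \<in> ?R" by (intro UN_I[of "x - u"]) auto
  next
    fix x assume "x \<in> ?R"
    then obtain i where "i \<in> I" "x - i \<in> U" by auto
    moreover have "coset I x = coset I (x - i)" using \<open>i \<in> I\<close> by (simp add: coset_eq_iff[OF I])
    ultimately show "x \<in> ?L" by auto
  qed
  then show ?thesis
    using openin_seminorm_topology_translation[OF U] by (auto simp: openin_quotient_topology)
qed

text \<open>Representatives are chosen almost as close to 0 as their cosets allow. The quotient map
  is open, so \<open>X n\<close> eventually lies in the image of any given ball around 0, which
  forces these representatives to be null.\<close>

lemma quotient_null_sequence_lift:
  assumes I: "subspace I" and met: "metrizable_space (seminorm_topology P)"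
    and X: "\<And>n. X n \<in> range (coset I)"
    and lim: "limitin (quotient_topology (seminorm_topology P) (coset I)) X (coset I 0) sequentially"
  shows "\<exists>y. (\<forall>n. coset I (y n) = X n) \<and> limitin (seminorm_topology P) y 0 sequentially"
proof -
  obtain M d where Md: "Metric_space M d" "seminorm_topology P = Metric_space.mtopology M d"
    using met by (auto simp: metrizable_space_def)
  interpret Metric_space M d by fact
  have M: "M = UNIV" using topspace_seminorm_topology[of P] by (simp add: Md(2))
  define D where "D n = d 0 ` {y. coset I y = X n}" for n
  have bdd: "bdd_below (D n)" for n by (auto simp: D_def intro!: bdd_belowI[of _ 0])
  \<comment> \<open>The distance from 0 to a coset need not be attained; the slack
    \<open>1 / Suc n\<close> tends to 0 and is absorbed by half of \<open>e\<close> below.\<close>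
  have "\<exists>y. coset I y = X n \<and> d 0 y < Inf (D n) + 1 / Suc n" for n
  proof -
    have "D n \<noteq> {}" using X[of n] by (auto simp: D_def)
    then obtain r where "r \<in> D n" "r < Inf (D n) + 1 / Suc n"
      using cInf_lessD[of "D n" "Inf (D n) + 1 / Suc n"] by auto
    then show ?thesis by (auto simp: D_def)
  qed
  then obtain y where y: "\<And>n. coset I (y n) = X n" "\<And>n. d 0 (y n) < Inf (D n) + 1 / Suc n"
    by metis
  have "limitin mtopology y 0 sequentially"
    unfolding limitin_metric
  proof (intro conjI allI impI)
    fix e :: real assume e: "0 < e"
    have "openin (seminorm_topology P) (mball 0 (e / 2))" by (simp add: Md(2))
    from openin_quotient_coset_image[OF I this]
    have "openin (quotient_topology (seminorm_topology P) (coset I)) (coset I ` mball 0 (e / 2))" .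
    moreover have "coset I 0 \<in> coset I ` mball 0 (e / 2)" using e M by (intro imageI centre_in_mball_iff[THEN iffD2]) simp
    ultimately have "eventually (\<lambda>n. X n \<in> coset I ` mball 0 (e / 2)) sequentially"
      using lim unfolding limitin_def by blast
    moreover have "eventually (\<lambda>n. 1 / Suc n < e / 2) sequentially"
      using e order_tendstoD(2)[OF LIMSEQ_inverse_real_of_nat, of "e / 2"] by (simp add: inverse_eq_divide)
    ultimately show "eventually (\<lambda>n. y n \<in> M \<and> d (y n) 0 < e) sequentially"
    proof eventually_elim
      case (elim n)
      then obtain z where "coset I z = X n" "d 0 z < e / 2" by auto
      then have "Inf (D n) < e / 2"
        using cInf_lower[OF _ bdd[of n], of "d 0 z"] by (auto simp: D_def)
      then show ?case using y(2)[of n] elim(2) by (simp add: M commute)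
    qed
  qed (simp add: M)
  with y(1) show ?thesis by (auto simp: Md(2))
qed

section \<open>Projection onto the disjoint complement of a closed ideal\<close>

lemma riesz_idealD:
  assumes "riesz_ideal I"
  shows "subspace I" "y \<in> I \<Longrightarrow> \<bar>x\<bar> \<le> \<bar>y\<bar> \<Longrightarrow> x \<in> I"
  using assms by (auto simp: riesz_ideal_def)

lemma riesz_ideal_interval:
  assumes "riesz_ideal I" "y \<in> I" "0 \<le> x" "x \<le> y" shows "x \<in> I"
  using riesz_idealD(2)[OF assms(1,2), of x] assms(3,4) by (auto intro: order_trans)

lemma riesz_ideal_abs: "riesz_ideal I \<Longrightarrow> x \<in> I \<Longrightarrow> \<bar>x\<bar> \<in> I"
  using riesz_idealD(2)[of I x "\<bar>x\<bar>"] by simp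

lemma riesz_ideal_sup:
  assumes I: "riesz_ideal I" and x: "x \<in> I" "0 \<le> x" and y: "y \<in> I" "0 \<le> y"
  shows "sup x y \<in> I"
proof (rule riesz_ideal_interval[OF I])
  show "x + y \<in> I" using x y riesz_idealD(1)[OF I] by (simp add: subspace_add)
qed (use x y in \<open>auto intro: le_supI1\<close>)

text \<open>Equivalent to \<open>\<bar>v\<bar> \<sqinter> \<bar>u\<bar> = 0\<close> for all \<open>u \<in> I\<close>, but with no infimum to compute.\<close>

definition disjoint_complement :: "'a::riesz_space set \<Rightarrow> 'a set" where
  "disjoint_complement I = {v. \<forall>u\<in>I. 0 \<le> u \<and> u \<le> \<bar>v\<bar> \<longrightarrow> u = 0}"

lemma disjoint_complementD:
  "v \<in> disjoint_complement I \<Longrightarrow> u \<in> I \<Longrightarrow> 0 \<le> u \<Longrightarrow> u \<le> \<bar>v\<bar> \<Longrightarrow> u = 0"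
  by (auto simp: disjoint_complement_def)

text \<open>For sums: if \<open>u\<close> in \<open>I\<close> satisfies
  \<open>0 \<le> u \<le> \<bar>v + w\<bar>\<close>, then \<open>inf u \<bar>v\<bar>\<close> is in
  \<open>I\<close> and below \<open>\<bar>v\<bar>\<close>, hence 0. Thus \<open>u\<close> is the
  positive part of \<open>u - \<bar>v\<bar>\<close>, which is below \<open>\<bar>w\<bar>\<close>.
  For multiples, \<open>u\<close> is divided by \<open>\<bar>c\<bar>\<close>.\<close>

lemma subspace_disjoint_complement:
  fixes I :: "'a::riesz_space set"
  assumes I: "riesz_ideal I"
  shows "subspace (disjoint_complement I)"
proof (rule subspaceI)
  show "0 \<in> disjoint_complement I" by (auto simp: disjoint_complement_def)
next
  fix v w assume v: "v \<in> disjoint_complement I" and w: "w \<in> disjoint_complement I"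
  show "v + w \<in> disjoint_complement I"
    unfolding disjoint_complement_def
  proof (intro CollectI ballI impI, elim conjE)
    fix u assume u: "u \<in> I" "0 \<le> u" "u \<le> \<bar>v + w\<bar>"
    have le: "u \<le> \<bar>v\<bar> + \<bar>w\<bar>" using u(3) abs_triangle_ineq by (rule order_trans)
    have "inf u \<bar>v\<bar> \<in> I" by (rule riesz_ideal_interval[OF I u(1)]) (use u in auto)
    then have "inf u \<bar>v\<bar> = 0" by (rule disjoint_complementD[OF v]) (use u in auto)
    then have "u = sup 0 (u - \<bar>v\<bar>)"
      using diff_inf_eq_sup[of u u "\<bar>v\<bar>"] by (simp add: add_sup_distrib_left)
    also have "\<dots> \<le> \<bar>w\<bar>" using le by (simp add: algebra_simps)
    finally show "u = 0" using u by (intro disjoint_complementD[OF w])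
  qed
next
  fix c :: real and v assume v: "v \<in> disjoint_complement I"
  show "c *\<^sub>R v \<in> disjoint_complement I"
    unfolding disjoint_complement_def
  proof (intro CollectI ballI impI, elim conjE)
    fix u assume u: "u \<in> I" "0 \<le> u" "u \<le> \<bar>c *\<^sub>R v\<bar>"
    show "u = 0"
    proof (cases "c = 0")
      case False
      have abs_le: "\<bar>c *\<^sub>R v\<bar> \<le> \<bar>c\<bar> *\<^sub>R \<bar>v\<bar>"
      proof (rule abs_leI)
        show "c *\<^sub>R v \<le> \<bar>c\<bar> *\<^sub>R \<bar>v\<bar>"
          using scaleR_left_mono[OF abs_ge_self[of v], of c] scaleR_left_mono[OF abs_ge_minus_self[of v], of "- c"]
          by (cases "0 \<le> c") auto
        show "- (c *\<^sub>R v) \<le> \<bar>c\<bar> *\<^sub>R \<bar>v\<bar>"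
          using scaleR_left_mono[OF abs_ge_self[of v], of "- c"] scaleR_left_mono[OF abs_ge_minus_self[of v], of c]
          by (cases "0 \<le> c") auto
      qed
      have "(1 / \<bar>c\<bar>) *\<^sub>R u \<le> (1 / \<bar>c\<bar>) *\<^sub>R (\<bar>c\<bar> *\<^sub>R \<bar>v\<bar>)"
        using u(3) abs_le by (intro scaleR_left_mono) auto
      then have "(1 / \<bar>c\<bar>) *\<^sub>R u \<le> \<bar>v\<bar>" using False by simp
      then have "(1 / \<bar>c\<bar>) *\<^sub>R u = 0"
        using u riesz_idealD(1)[OF I]
        by (intro disjoint_complementD[OF v]) (auto simp: subspace_scale intro: scaleR_nonneg_nonneg)
      then show ?thesis using False by simp
    qed (use u in auto)
  qed
qed

text \<open>The positive part of \<open>\<bar>v\<bar> - \<bar>u + v\<bar>\<close> is at most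
  \<open>\<bar>u\<bar>\<close>, hence in \<open>I\<close>, and at most \<open>\<bar>v\<bar>\<close>,
  hence 0. This is why the projection does not increase moduli.\<close>

lemma disjoint_complement_component_abs_le:
  fixes u v :: "'a::riesz_space"
  assumes I: "riesz_ideal I" and u: "u \<in> I" and v: "v \<in> disjoint_complement I"
  shows "\<bar>v\<bar> \<le> \<bar>u + v\<bar>"
proof -
  let ?w = "sup 0 (\<bar>v\<bar> - \<bar>u + v\<bar>)"
  have "\<bar>v\<bar> \<le> \<bar>u + v\<bar> + \<bar>u\<bar>" using abs_triangle_ineq4[of "u + v" u] by simp
  then have "?w \<le> \<bar>u\<bar>" by (simp add: algebra_simps)
  then have "?w \<in> I" by (intro riesz_ideal_interval[OF I riesz_ideal_abs[OF I u]]) auto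
  then have "?w = 0" by (rule disjoint_complementD[OF v]) auto
  then show ?thesis by (metis diff_le_0_iff_le sup_ge2)
qed

lemma disjoint_complement_Int_ideal:
  assumes "riesz_ideal I" "v \<in> I" "v \<in> disjoint_complement I" shows "v = 0"
  using disjoint_complementD[OF assms(3) riesz_ideal_abs[OF assms(1,2)]] by simp

text \<open>The negative part of \<open>v\<close> is at most \<open>\<bar>w\<bar>\<close>, hence in
  \<open>I\<close>, and also at most \<open>\<bar>v\<bar>\<close>. The lemma makes representatives
  of positive cosets positive.\<close>

lemma disjoint_complement_nonneg:
  fixes v w :: "'a::riesz_space"
  assumes I: "riesz_ideal I" and v: "v \<in> disjoint_complement I" and w: "w \<in> I" "w \<le> v"
  shows "0 \<le> v"
proof -
  have "- v \<le> \<bar>w\<bar>" using w(2) abs_ge_minus_self[of w] by (metis neg_le_iff_le order_trans)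
  then have "sup 0 (- v) \<in> I" by (intro riesz_ideal_interval[OF I riesz_ideal_abs[OF I w(1)]]) auto
  then have "sup 0 (- v) = 0" by (rule disjoint_complementD[OF v]) (auto simp: abs_ge_minus_self)
  then have "- v \<le> 0" by (metis sup_ge2)
  then show ?thesis by simp
qed

text \<open>The successive differences of an increasing sequence below \<open>x\<close> are weakly null, because their
  values under a positive functional \<open>h\<close> sum up to at most \<open>h x\<close>; so they cannot stay away from \<open>0\<close>.\<close>

lemma PSP_order_bounded_directed_Cauchy:
  fixes D :: "'a::riesz_space set"
  assumes P: "\<forall>p\<in>P. riesz_seminorm p"
    and PSP: "positive_schur_property UNIV 0 (\<le>) (weak_topology (seminorm_topology P)) (seminorm_topology P)"
    and D: "D \<noteq> {}" "\<And>u. u \<in> D \<Longrightarrow> 0 \<le> u \<and> u \<le> x"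
    and Q: "finite Q" "Q \<subseteq> P" and e: "0 < e"
  shows "\<exists>u\<in>D. \<forall>v\<in>D. u \<le> v \<longrightarrow> (\<Sum>p\<in>Q. p (v - u)) < e"
proof (rule ccontr)
  assume "\<not> ?thesis"
  then have step: "\<exists>v\<in>D. u \<le> v \<and> e \<le> (\<Sum>p\<in>Q. p (v - u))" if "u \<in> D" for u
    using that by (auto simp: not_less)
  \<comment> \<open>Dependent choice yields an increasing sequence in \<open>D\<close> all of whose
    steps have size at least \<open>e\<close>.\<close>
  obtain u where u: "\<And>n. u n \<in> D" "\<And>n. u n \<le> u (Suc n) \<and> e \<le> (\<Sum>p\<in>Q. p (u (Suc n) - u n))"
    using dependent_nat_choice[of "\<lambda>_ u. u \<in> D" "\<lambda>_ u v. u \<le> v \<and> e \<le> (\<Sum>p\<in>Q. p (v - u))"] D(1) step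
    by (metis ex_in_conv)
  define d where "d n = u (Suc n) - u n" for n
  have "(\<Sum>k<n. d k) \<le> x" for n
  proof -
    have "(\<Sum>k<n. d k) = u n - u 0" by (simp add: d_def sum_lessThan_telescope)
    also have "\<dots> \<le> u n" using D(2)[OF u(1)[of 0]] by simp
    also have "\<dots> \<le> x" using D(2)[OF u(1)[of n]] by simp
    finally show ?thesis .
  qed
  moreover have d0: "0 \<le> d n" for n using u(2)[of n] by (simp add: d_def)
  ultimately have "limitin (weak_topology (seminorm_topology P)) d 0 sequentially"
    using weakly_null_of_bounded_partial_sums[OF P] by blast
  then have "limitin (seminorm_topology P) d 0 sequentially"
    using PSP d0 by (simp add: positive_schur_property_def)
  then have "\<forall>p\<in>Q. (\<lambda>n. p (d n)) \<longlonglongrightarrow> 0"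
    using Q(2) by (auto simp: limitin_seminorm_topology[OF P])
  then have "(\<lambda>n. \<Sum>p\<in>Q. p (d n)) \<longlonglongrightarrow> (\<Sum>p\<in>Q. 0)" by (intro tendsto_sum) auto
  then have "eventually (\<lambda>n. (\<Sum>p\<in>Q. p (d n)) < e) sequentially"
    using e by (auto dest: order_tendstoD(2))
  then show False using u(2) by (auto simp: d_def eventually_sequentially not_less[symmetric])
qed

text \<open>Otherwise the constant sequence 0 would have the two limits 0 and
  \<open>z\<close>.\<close>

lemma seminorm_topology_separates:
  assumes P: "\<forall>p\<in>P. riesz_seminorm p" and "Hausdorff_space (seminorm_topology P)"
    and z: "\<And>p. p \<in> P \<Longrightarrow> p z = 0"
  shows "z = 0"
proof -
  have "limitin (seminorm_topology P) (\<lambda>_. 0) 0 sequentially"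
    using P by (auto simp: limitin_seminorm_topology[OF P])
  moreover have "limitin (seminorm_topology P) (\<lambda>_. 0) z sequentially"
    unfolding limitin_seminorm_topology[OF P]
  proof
    fix p assume p: "p \<in> P"
    have "p (0 - z) = 0" using z[OF p] riesz_seminorm_minus[of p z] P p by simp
    then show "(\<lambda>n. p (0 - z)) \<longlonglongrightarrow> 0" by simp
  qed
  ultimately show ?thesis using assms(2) limitin_Hausdorff_unique trivial_limit_sequentially by metis
qed

lemma complete_linear_topologyD:
  assumes "complete_linear_topology \<tau>" "F \<noteq> bot"
    and "\<And>U. openin \<tau> U \<Longrightarrow> 0 \<in> U \<Longrightarrow>
      \<exists>A. eventually (\<lambda>x. x \<in> A) F \<and> (\<forall>x\<in>A. \<forall>y\<in>A. x - y \<in> U)"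
  shows "\<exists>l. limitin \<tau> (\<lambda>x. x) l F"
  using assms by (simp add: complete_linear_topology_def)

text \<open>The limit of the net of all positive elements of \<open>I\<close> below \<open>x\<close> is the largest of them.\<close>

lemma PSP_closed_ideal_greatest:
  fixes x :: "'a::riesz_space"
  assumes P: "\<forall>p\<in>P. riesz_seminorm p"
    and Hausdorff: "Hausdorff_space (seminorm_topology P)"
    and complete: "complete_linear_topology (seminorm_topology P)"
    and PSP: "positive_schur_property UNIV 0 (\<le>) (weak_topology (seminorm_topology P)) (seminorm_topology P)"
    and I: "riesz_ideal I" "closedin (seminorm_topology P) I"
    and x: "0 \<le> x"
  obtains l where "l \<in> I" "0 \<le> l" "l \<le> x" "\<And>u. u \<in> I \<Longrightarrow> 0 \<le> u \<Longrightarrow> u \<le> x \<Longrightarrow> u \<le> l"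
proof -
  define D where "D = {u \<in> I. 0 \<le> u \<and> u \<le> x}"
  \<comment> \<open>The filter of tails of \<open>D\<close>, which encodes the net indexed by
    \<open>D\<close> itself. Since \<open>D\<close> is closed under \<open>sup\<close>, the tails
    form a filter base.\<close>
  define F where "F = (INF u\<in>D. principal {v \<in> D. u \<le> v})"
  have D0: "0 \<in> D" using x riesz_idealD(1)[OF I(1)] by (simp add: D_def subspace_0)
  have ev: "eventually R F \<longleftrightarrow> (\<exists>u\<in>D. \<forall>v\<in>D. u \<le> v \<longrightarrow> R v)" for R
  proof -
    have "eventually R F \<longleftrightarrow> (\<exists>u\<in>D. eventually R (principal {v \<in> D. u \<le> v}))"
      unfolding F_def
    proof (rule eventually_INF_base)
      fix a b assume "a \<in> D" "b \<in> D"
      then have "sup a b \<in> D" using riesz_ideal_sup[OF I(1)] by (auto simp: D_def intro: le_supI1)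
      then show "\<exists>c\<in>D. principal {v \<in> D. c \<le> v} \<le> inf (principal {v \<in> D. a \<le> v}) (principal {v \<in> D. b \<le> v})"
        by (intro bexI[of _ "sup a b"]) auto
    qed (use D0 in auto)
    moreover have "eventually R (principal {v \<in> D. u \<le> v}) \<longleftrightarrow> (\<forall>v\<in>D. u \<le> v \<longrightarrow> R v)" for u
      by (auto simp: eventually_principal)
    ultimately show ?thesis by (simp only:)
  qed
  have "\<not> eventually (\<lambda>_. False) F" unfolding ev by blast
  then have F: "F \<noteq> bot" by (simp add: trivial_limit_def)
  have cauchy: "\<exists>A. eventually (\<lambda>x. x \<in> A) F \<and> (\<forall>x\<in>A. \<forall>y\<in>A. x - y \<in> U)"
    if U: "openin (seminorm_topology P) U" "0 \<in> U" for U
  proof -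
    obtain Q e where Q: "finite Q" "Q \<subseteq> P" "0 < e" "{x. \<forall>p\<in>Q. p (x - 0) < e} \<subseteq> U"
      by (rule openin_seminorm_topologyD[OF P U])
    \<comment> \<open>Half the radius, because two elements of the tail are compared through
      \<open>u\<close>.\<close>
    have "\<exists>u\<in>D. \<forall>v\<in>D. u \<le> v \<longrightarrow> (\<Sum>p\<in>Q. p (v - u)) < e / 2"
    proof (rule PSP_order_bounded_directed_Cauchy[OF P PSP _ _ Q(1,2)])
      show "0 \<le> u \<and> u \<le> x" if "u \<in> D" for u using that by (simp add: D_def)
    qed (use D0 Q(3) in auto)
    then obtain u where u: "u \<in> D" "\<And>v. v \<in> D \<Longrightarrow> u \<le> v \<Longrightarrow> (\<Sum>p\<in>Q. p (v - u)) < e / 2"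
      by blast
    have *: "p (v - u) < e / 2" if "v \<in> D" "u \<le> v" "p \<in> Q" for p v
    proof -
      have "p (v - u) \<le> (\<Sum>p\<in>Q. p (v - u))"
        using Q(1,2) that P by (intro member_le_sum riesz_seminorm_nonneg) auto
      then show ?thesis using u(2)[OF that(1,2)] by simp
    qed
    have "v - w \<in> U" if "v \<in> D" "u \<le> v" "w \<in> D" "u \<le> w" for v w
    proof -
      have "p (v - w) < e" if p: "p \<in> Q" for p
      proof -
        have r: "riesz_seminorm p" using P p Q(2) by auto
        show ?thesis
          using riesz_seminorm_triangle_diff[OF r, of v w u] riesz_seminorm_diff_commute[OF r, of u w]
            *[OF \<open>v \<in> D\<close> \<open>u \<le> v\<close> p] *[OF \<open>w \<in> D\<close> \<open>u \<le> w\<close> p] by simp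
      qed
      then show ?thesis using Q(4) by auto
    qed
    then show ?thesis using u(1) by (intro exI[of _ "{v \<in> D. u \<le> v}"]) (auto simp: ev)
  qed
  then obtain l where l: "limitin (seminorm_topology P) (\<lambda>x. x) l F"
    using complete_linear_topologyD[OF complete F cauchy] by blast
  have "eventually (\<lambda>v. v \<in> I) F"
    unfolding ev using D0 by (intro bexI[of _ 0]) (simp_all add: D_def)
  then have "l \<in> I" by (rule limitin_closedin[OF l I(2) _ F])
  \<comment> \<open>Closure under \<open>sup\<close> lets the element near \<open>l\<close> be taken
    above any prescribed \<open>u\<close>.\<close>
  have near: "\<exists>v\<in>D. u \<le> v \<and> p (v - l) < e" if "u \<in> D" "p \<in> P" "0 < e" for u p and e :: real
  proof -
    have "((\<lambda>v. p (v - l)) \<longlongrightarrow> 0) F"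
      using l that(2) by (simp add: limitin_seminorm_topology[OF P])
    then have "eventually (\<lambda>v. p (v - l) < e) F" using that(3) by (rule order_tendstoD(2))
    then obtain u' where u': "u' \<in> D" "\<And>v. v \<in> D \<Longrightarrow> u' \<le> v \<Longrightarrow> p (v - l) < e"
      unfolding ev by blast
    have "sup u u' \<in> D" using that(1) u'(1) riesz_ideal_sup[OF I(1)] by (auto simp: D_def intro: le_supI1)
    then show ?thesis using u'(2) by (intro bexI[of _ "sup u u'"]) auto
  qed
  \<comment> \<open>Order relations pass to the limit through this fact: \<open>v - l\<close> is
    arbitrarily small in each seminorm, so every seminorm vanishes on the positive part of
    \<open>z\<close>. It is applied to \<open>l - x\<close> and to \<open>u - l\<close>.\<close>
  have nonpos: "z \<le> 0" if u: "u \<in> D" and z: "\<And>v. v \<in> D \<Longrightarrow> u \<le> v \<Longrightarrow> z \<le> \<bar>v - l\<bar>" for u z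
  proof -
    have "p (sup z 0) = 0" if p: "p \<in> P" for p
    proof (rule antisym)
      have r: "riesz_seminorm p" using P p by auto
      show "0 \<le> p (sup z 0)" using r by (rule riesz_seminorm_nonneg)
      show "p (sup z 0) \<le> 0"
      proof (rule field_le_epsilon)
        fix e :: real assume "0 < e"
        then obtain v where v: "v \<in> D" "u \<le> v" "p (v - l) < e" using near[OF u p] by blast
        have "p (sup z 0) \<le> p (v - l)"
          using z[OF v(1,2)] by (intro riesz_seminormD(3)[OF r]) simp
        then show "p (sup z 0) \<le> 0 + e" using v(3) by simp
      qed
    qed
    then have "sup z 0 = 0" by (rule seminorm_topology_separates[OF P Hausdorff])
    then show ?thesis by (metis sup_ge1)
  qed
  have "l \<le> x"
  proof -
    have "l - x \<le> \<bar>v - l\<bar>" if "v \<in> D" for v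
    proof -
      have "l - x \<le> l - v" using that by (simp add: D_def)
      also have "\<dots> \<le> \<bar>v - l\<bar>" using abs_ge_minus_self[of "v - l"] by simp
      finally show ?thesis .
    qed
    then show ?thesis using nonpos[OF D0, of "l - x"] by simp
  qed
  have above: "u \<le> l" if "u \<in> D" for u
  proof -
    have "u - l \<le> \<bar>v - l\<bar>" if "u \<le> v" for v
    proof -
      have "u - l \<le> v - l" using that by simp
      also have "\<dots> \<le> \<bar>v - l\<bar>" by (rule abs_ge_self)
      finally show ?thesis .
    qed
    then show ?thesis using nonpos[OF that, of "u - l"] by simp
  qed
  show thesis
    by (rule that[OF \<open>l \<in> I\<close> above[OF D0] \<open>l \<le> x\<close>]) (simp add: above D_def)
qed

text \<open>From \<open>x \<ge> 0\<close> subtract the largest element \<open>l\<close> of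
  \<open>I\<close> between 0 and \<open>x\<close>. If \<open>u\<close> in \<open>I\<close> lies
  between 0 and \<open>x - l\<close>, then \<open>l + u\<close> also competes with \<open>l\<close>,
  so \<open>u = 0\<close>. General elements are differences of positive ones.\<close>

lemma projection_onto_disjoint_complement:
  fixes I :: "'a::riesz_space set"
  assumes P: "\<forall>p\<in>P. riesz_seminorm p"
    and Hausdorff: "Hausdorff_space (seminorm_topology P)"
    and complete: "complete_linear_topology (seminorm_topology P)"
    and PSP: "positive_schur_property UNIV 0 (\<le>) (weak_topology (seminorm_topology P)) (seminorm_topology P)"
    and I: "riesz_ideal I" "closedin (seminorm_topology P) I"
  shows "\<exists>\<pi>. linear \<pi> \<and> (\<forall>x. x - \<pi> x \<in> I \<and> \<pi> x \<in> disjoint_complement I \<and> \<bar>\<pi> x\<bar> \<le> \<bar>x\<bar>) \<and>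
    (\<forall>x\<in>I. \<pi> x = 0)"
proof -
  let ?J = "disjoint_complement I"
  note sI = riesz_idealD(1)[OF I(1)] and sJ = subspace_disjoint_complement[OF I(1)]
  have pos: "\<exists>v\<in>?J. x - v \<in> I" if x: "0 \<le> x" for x
  proof -
    obtain l where l: "l \<in> I" "0 \<le> l" "l \<le> x" "\<And>u. u \<in> I \<Longrightarrow> 0 \<le> u \<Longrightarrow> u \<le> x \<Longrightarrow> u \<le> l"
      using PSP_closed_ideal_greatest[OF P Hausdorff complete PSP I x] by blast
    have "u = 0" if "u \<in> I" "0 \<le> u" "u \<le> \<bar>x - l\<bar>" for u
    proof -
      have "u \<le> x - l" using that(3) l(3) by simp
      then have "l + u \<le> l"
        using that l sI by (intro l(4)) (auto simp: subspace_add algebra_simps)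
      then show "u = 0" using that(2) by simp
    qed
    then have "x - l \<in> ?J" by (auto simp: disjoint_complement_def)
    then show ?thesis using l(1) by (intro bexI[of _ "x - l"]) auto
  qed
  have "\<exists>v. v \<in> ?J \<and> x - v \<in> I" for x
  proof -
    obtain v w where v: "v \<in> ?J" "pprt x - v \<in> I" and w: "w \<in> ?J" "- nprt x - w \<in> I"
      using pos[of "pprt x"] pos[of "- nprt x"] by auto
    have "(pprt x - v) - (- nprt x - w) = x - (v - w)"
      using prts[of x] by (simp add: algebra_simps)
    from subspace_diff[OF sI v(2) w(2), unfolded this]
    show ?thesis using subspace_diff[OF sJ v(1) w(1)] by (intro exI[of _ "v - w"] conjI)
  qed
  then obtain \<pi> where \<pi>: "\<And>x. \<pi> x \<in> ?J" "\<And>x. x - \<pi> x \<in> I" by metis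
  \<comment> \<open>The ideal meets its disjoint complement only in 0. Linearity of
    \<open>\<pi>\<close> and its vanishing on \<open>I\<close> follow by exhibiting the right
    component.\<close>
  have unique: "\<pi> x = v" if "v \<in> ?J" "x - v \<in> I" for x v
  proof -
    have "\<pi> x - v \<in> I" using subspace_diff[OF sI that(2) \<pi>(2)[of x]] by simp
    then have "\<pi> x - v = 0"
      using subspace_diff[OF sJ \<pi>(1)[of x] that(1)] by (rule disjoint_complement_Int_ideal[OF I(1)])
    then show ?thesis by simp
  qed
  have "linear \<pi>"
  proof (rule linearI)
    fix x y
    have "(x + y) - (\<pi> x + \<pi> y) \<in> I"
      using subspace_add[OF sI \<pi>(2)[of x] \<pi>(2)[of y]] by (simp add: algebra_simps)
    then show "\<pi> (x + y) = \<pi> x + \<pi> y" using subspace_add[OF sJ \<pi>(1) \<pi>(1)] by (intro unique)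
  next
    fix c x
    have "c *\<^sub>R x - c *\<^sub>R \<pi> x \<in> I"
      using subspace_scale[OF sI \<pi>(2)[of x], of c] by (simp add: algebra_simps)
    then show "\<pi> (c *\<^sub>R x) = c *\<^sub>R \<pi> x" using subspace_scale[OF sJ \<pi>(1)] by (intro unique)
  qed
  moreover have "\<bar>\<pi> x\<bar> \<le> \<bar>x\<bar>" for x
    using disjoint_complement_component_abs_le[OF I(1) \<pi>(2)[of x] \<pi>(1)[of x]] by simp
  moreover have "\<pi> x = 0" if "x \<in> I" for x
    using that subspace_0[OF sJ] by (intro unique) auto
  ultimately show ?thesis using \<pi> by (intro exI[of _ \<pi>]) simp
qed

text \<open>The representatives \<open>\<pi> (x n)\<close> of the cosets are weakly null, since \<open>f \<circ> \<pi>\<close> is a continuous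
  functional vanishing on \<open>I\<close> whenever \<open>f\<close> is continuous.\<close>

lemma PSP_quotient_weakly_null_lift:
  fixes I :: "'a::riesz_space set"
  assumes P: "\<forall>p\<in>P. riesz_seminorm p"
    and Hausdorff: "Hausdorff_space (seminorm_topology P)"
    and complete: "complete_linear_topology (seminorm_topology P)"
    and PSP: "positive_schur_property UNIV 0 (\<le>) (weak_topology (seminorm_topology P)) (seminorm_topology P)"
    and I: "riesz_ideal I" "closedin (seminorm_topology P) I"
    and X: "\<And>n. X n \<in> range (coset I)"
    and lim: "limitin (quotient_topology (weak_topology (seminorm_topology P)) (coset I)) X (coset I 0) F"
  shows "\<exists>v. (\<forall>n. coset I (v n) = X n \<and> v n \<in> disjoint_complement I) \<and>
    limitin (weak_topology (seminorm_topology P)) v 0 F"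
proof -
  from projection_onto_disjoint_complement[OF P Hausdorff complete PSP I]
  obtain \<pi> where "linear \<pi>" and
    \<pi>: "\<forall>x. x - \<pi> x \<in> I \<and> \<pi> x \<in> disjoint_complement I \<and> \<bar>\<pi> x\<bar> \<le> \<bar>x\<bar>" "\<forall>x\<in>I. \<pi> x = 0"
    by (elim exE conjE)
  note sI = riesz_idealD(1)[OF I(1)]
  have "\<exists>x. X n = coset I x" for n using X[of n] by blast
  then obtain x where x: "\<And>n. X n = coset I (x n)" by metis
  have "limitin (weak_topology (seminorm_topology P)) (\<lambda>n. \<pi> (x n)) 0 F"
    unfolding limitin_weak_topology
  proof (intro allI impI)
    fix f :: "'a \<Rightarrow> real"
    assume "linear f \<and> continuous_map (seminorm_topology P) euclideanreal f"
    then have f: "linear f" "continuous_map (seminorm_topology P) euclideanreal f" by auto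
    obtain Q C where Q: "finite Q" "Q \<subseteq> P" "0 \<le> C" "\<And>x. \<bar>f x\<bar> \<le> C * (\<Sum>p\<in>Q. p x)"
      using continuous_linear_seminorm_bound[OF P f] by blast
    have lin: "linear (\<lambda>x. f (\<pi> x))" using linear_compose[OF \<open>linear \<pi>\<close> f(1)] by (simp add: o_def)
    have "\<bar>f (\<pi> x)\<bar> \<le> C * (\<Sum>p\<in>Q. p x)" for x
    proof -
      have "(\<Sum>p\<in>Q. p (\<pi> x)) \<le> (\<Sum>p\<in>Q. p x)"
        using P Q(2) \<pi>(1) by (intro sum_mono riesz_seminormD(3)) auto
      from order_trans[OF Q(4) mult_left_mono[OF this Q(3)]] show ?thesis .
    qed
    then have "continuous_map (seminorm_topology P) euclideanreal (\<lambda>x. f (\<pi> x))"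
      by (rule continuous_linear_of_seminorm_bound[OF P lin Q(1,2)])
    then have "((\<lambda>n. f (\<pi> (x n))) \<longlongrightarrow> 0) F"
      by (rule limitin_quotient_weak_topologyD[OF sI lim[unfolded x] lin])
        (simp add: \<pi>(2) linear_0[OF f(1)])
    then show "((\<lambda>n. f (\<pi> (x n))) \<longlongrightarrow> f 0) F" by (simp add: linear_0[OF f(1)])
  qed
  moreover have "coset I (\<pi> (x n)) = X n" for n
    using coset_eq_iff[OF sI, of "x n" "\<pi> (x n)"] \<pi>(1) by (simp add: x)
  ultimately show ?thesis using \<pi>(1) by (intro exI[of _ "\<lambda>n. \<pi> (x n)"]) simp
qed

section \<open>The three-space theorem\<close>

theorem corollary2p4:
  fixes \<tau> :: "'a::riesz_space topology" and I :: "'a set"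
  assumes "frechet_lattice \<tau>"
    and "dedekind_sigma_complete TYPE('a)"
    and "riesz_ideal I" and "closedin \<tau> I"
  defines "E_PSP \<equiv> positive_schur_property UNIV 0 (\<le>) (weak_topology \<tau>) \<tau>"
    and "I_PSP \<equiv> positive_schur_property I 0 (\<le>)
                   (subtopology (weak_topology \<tau>) I) (subtopology \<tau> I)"
    and "Q_PSP \<equiv> positive_schur_property (range (coset I)) (coset I 0) coset_le
                   (quotient_topology (weak_topology \<tau>) (coset I)) (quotient_topology \<tau> (coset I))"
    and "E_SP \<equiv> schur_property UNIV 0 (weak_topology \<tau>) \<tau>"
    and "I_SP \<equiv> schur_property I 0 (subtopology (weak_topology \<tau>) I) (subtopology \<tau> I)"
    and "Q_SP \<equiv> schur_property (range (coset I)) (coset I 0)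
                   (quotient_topology (weak_topology \<tau>) (coset I)) (quotient_topology \<tau> (coset I))"
  shows "((E_PSP \<and> I_PSP \<longrightarrow> Q_PSP) \<and> (E_PSP \<and> Q_PSP \<longrightarrow> I_PSP) \<and> (I_PSP \<and> Q_PSP \<longrightarrow> E_PSP)) \<and>
         ((E_SP \<and> I_SP \<longrightarrow> Q_SP) \<and> (E_SP \<and> Q_SP \<longrightarrow> I_SP) \<and> (I_SP \<and> Q_SP \<longrightarrow> E_SP))"
proof -
  obtain P where P: "\<forall>p\<in>P. riesz_seminorm p" and \<tau>: "\<tau> = seminorm_topology P"
    using assms(1) by (auto simp: frechet_lattice_def locally_convex_solid_def)
  have met: "metrizable_space (seminorm_topology P)"
    and complete: "complete_linear_topology (seminorm_topology P)"
    using assms(1) by (auto simp: frechet_lattice_def \<tau>)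
  have Hausdorff: "Hausdorff_space (seminorm_topology P)"
    using met by (rule metrizable_imp_Hausdorff_space)
  note I = assms(3) assms(4)[unfolded \<tau>]
  note sI = riesz_idealD(1)[OF assms(3)]
  \<comment> \<open>Makes the projection, obtained from the positive Schur property, available for
    the Schur property as well.\<close>
  have E_SP_imp: "E_PSP" if "E_SP"
    using that by (simp add: E_SP_def E_PSP_def schur_property_def positive_schur_property_def)
  have lim_sub: "limitin (subtopology T I) x 0 sequentially \<longleftrightarrow> limitin T x 0 sequentially"
    if "\<And>n. x n \<in> I" for T :: "'a topology" and x
    using that sI by (auto simp: limitin_subtopology subspace_0)
  have weak_lift: "\<exists>v. (\<forall>n. coset I (v n) = X n \<and> v n \<in> disjoint_complement I) \<and>
      limitin (weak_topology \<tau>) v 0 sequentially"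
    if "E_PSP" "\<And>n. X n \<in> range (coset I)"
      "limitin (quotient_topology (weak_topology \<tau>) (coset I)) X (coset I 0) sequentially" for X
    using PSP_quotient_weakly_null_lift[OF P Hausdorff complete _ I, folded \<tau>] that
    unfolding E_PSP_def by blast
  have "Q_PSP" if "E_PSP"
    unfolding Q_PSP_def positive_schur_property_def
  proof (intro allI impI, elim conjE)
    fix X assume X: "\<forall>n. X n \<in> range (coset I) \<and> coset_le (coset I 0) (X n)"
      and lim: "limitin (quotient_topology (weak_topology \<tau>) (coset I)) X (coset I 0) sequentially"
    obtain v where v: "\<And>n. coset I (v n) = X n" "\<And>n. v n \<in> disjoint_complement I"
      "limitin (weak_topology \<tau>) v 0 sequentially"
      using weak_lift[OF \<open>E_PSP\<close> _ lim] X by blast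
    have "0 \<le> v n" for n
    proof -
      have "coset_le (coset I 0) (coset I (v n))" using X by (simp add: v(1))
      \<comment> \<open>With \<open>a\<close> in \<open>I\<close>, \<open>b\<close> in the coset of
        \<open>v n\<close> and \<open>a \<le> b\<close>, the element \<open>a - (b - v n)\<close> of
        \<open>I\<close> lies below \<open>v n\<close>.\<close>
      then obtain a b where ab: "a \<in> I" "b - v n \<in> I" "a \<le> b"
        by (auto simp: coset_le_def coset_def)
      show ?thesis
        using subspace_diff[OF sI ab(1,2)] ab(3)
        by (intro disjoint_complement_nonneg[OF I(1) v(2)]) (auto simp: algebra_simps)
    qed
    then have "limitin \<tau> v 0 sequentially"
      using \<open>E_PSP\<close> v(3) by (simp add: E_PSP_def positive_schur_property_def)
    from limitin_quotient_coset[OF this, of I]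
    show "limitin (quotient_topology \<tau> (coset I)) X (coset I 0) sequentially" by (simp add: v(1))
  qed
  moreover have "Q_SP" if "E_SP"
    unfolding Q_SP_def schur_property_def
  proof (intro allI impI, elim conjE)
    fix X assume X: "\<forall>n. X n \<in> range (coset I)"
      and lim: "limitin (quotient_topology (weak_topology \<tau>) (coset I)) X (coset I 0) sequentially"
    obtain v where v: "\<And>n. coset I (v n) = X n" "limitin (weak_topology \<tau>) v 0 sequentially"
      using weak_lift[OF E_SP_imp[OF \<open>E_SP\<close>] _ lim] X by blast
    then have "limitin \<tau> v 0 sequentially"
      using \<open>E_SP\<close> by (simp add: E_SP_def schur_property_def)
    from limitin_quotient_coset[OF this, of I]
    show "limitin (quotient_topology \<tau> (coset I)) X (coset I 0) sequentially" by (simp add: v(1))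
  qed
  moreover have "I_PSP" if "E_PSP"
    using that by (auto simp: E_PSP_def I_PSP_def positive_schur_property_def lim_sub)
  moreover have "I_SP" if "E_SP"
    using that by (auto simp: E_SP_def I_SP_def schur_property_def lim_sub)
  moreover have "E_PSP" if "I_PSP" "Q_PSP"
    unfolding E_PSP_def positive_schur_property_def
  proof (intro allI impI, elim conjE)
    fix x :: "nat \<Rightarrow> 'a"
    assume "\<forall>n. x n \<in> UNIV \<and> 0 \<le> x n" and lim: "limitin (weak_topology \<tau>) x 0 sequentially"
    then have x: "0 \<le> x n" for n by blast
    have "coset_le (coset I 0) (coset I (x n))" for n
      unfolding coset_le_def
      by (rule bexI[of _ 0], rule bexI[of _ "x n"]) (simp_all add: x coset_def subspace_0[OF sI])
    then have "limitin (quotient_topology \<tau> (coset I)) (\<lambda>n. coset I (x n)) (coset I 0) sequentially"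
      using \<open>Q_PSP\<close>[unfolded Q_PSP_def positive_schur_property_def, rule_format,
          of "\<lambda>n. coset I (x n)"] limitin_quotient_coset[OF lim] by simp
    then obtain z where z: "\<And>n. coset I (z n) = coset I (x n)" "limitin \<tau> z 0 sequentially"
      using quotient_null_sequence_lift[OF sI met, of "\<lambda>n. coset I (x n)", folded \<tau>] by blast
    \<comment> \<open>The difference \<open>x n - z n\<close> is in \<open>I\<close> but need not
      lie between 0 and \<open>x n\<close>. Truncating it to that interval keeps it in
      \<open>I\<close>, because the modulus does not grow, and makes it weakly null by
      domination.\<close>
    define y where "y n = inf (sup (x n - z n) 0) (x n)" for n
    have y: "0 \<le> y n" "y n \<le> x n" for n using x[of n] by (auto simp: y_def)
    have yI: "y n \<in> I" for n
    proof (rule riesz_idealD(2)[OF I(1)])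
      show "x n - z n \<in> I" using z(1)[of n] by (metis coset_eq_iff[OF sI])
      have "y n \<le> \<bar>x n - z n\<bar>" unfolding y_def by (rule le_infI1) (simp add: abs_ge_self)
      then show "\<bar>y n\<bar> \<le> \<bar>x n - z n\<bar>" using y(1)[of n] by simp
    qed
    have "limitin (weak_topology \<tau>) y 0 sequentially"
      using weakly_null_dominated[OF P lim[unfolded \<tau>] y] by (simp add: \<tau>)
    then have ylim: "limitin \<tau> y 0 sequentially"
      using \<open>I_PSP\<close> y(1) yI by (simp add: I_PSP_def positive_schur_property_def lim_sub)
    have "limitin \<tau> (\<lambda>n. x n - y n) 0 sequentially"
      unfolding \<tau>
    proof (rule limitin_seminorm_topology_dominated[OF P z(2)[unfolded \<tau>]])
      fix n
      \<comment> \<open>Subtraction from \<open>x n\<close> exchanges \<open>inf\<close> and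
        \<open>sup\<close>; the truncation thus leaves a remainder controlled by the null sequence
        \<open>z\<close>.\<close>
      have "x n - y n = sup (inf (z n) (x n)) 0"
        by (simp add: y_def diff_inf_eq_sup diff_sup_eq_inf add_sup_distrib_left add_inf_distrib_left)
      also have "\<dots> \<le> \<bar>z n\<bar>" by (simp add: le_infI1 abs_ge_self)
      finally show "\<bar>x n - y n\<bar> \<le> \<bar>z n\<bar>" using y(2)[of n] by simp
    qed
    from limitin_seminorm_topology_add[OF P this[unfolded \<tau>] ylim[unfolded \<tau>]]
    show "limitin \<tau> x 0 sequentially" by (simp add: \<tau>)
  qed
  moreover have "E_SP" if "I_SP" "Q_SP"
    unfolding E_SP_def schur_property_def
  proof (intro allI impI, elim conjE)
    fix x :: "nat \<Rightarrow> 'a"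
    assume lim: "limitin (weak_topology \<tau>) x 0 sequentially"
    have "limitin (quotient_topology \<tau> (coset I)) (\<lambda>n. coset I (x n)) (coset I 0) sequentially"
      using \<open>Q_SP\<close>[unfolded Q_SP_def schur_property_def, rule_format, of "\<lambda>n. coset I (x n)"]
        limitin_quotient_coset[OF lim] by simp
    then obtain z where z: "\<And>n. coset I (z n) = coset I (x n)" "limitin \<tau> z 0 sequentially"
      using quotient_null_sequence_lift[OF sI met, of "\<lambda>n. coset I (x n)", folded \<tau>] by blast
    have zI: "x n - z n \<in> I" for n using z(1)[of n] by (metis coset_eq_iff[OF sI])
    \<comment> \<open>Here \<open>x n - z n\<close> itself is the component in \<open>I\<close>:
      \<open>z\<close> is null, hence weakly null, and so is the difference of two weakly null
      sequences.\<close>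
    have "limitin (weak_topology \<tau>) (\<lambda>n. x n - z n) (0 - 0) sequentially"
      by (intro limitin_weak_topology_diff lim limitin_imp_limitin_weak_topology z(2))
    then have "limitin \<tau> (\<lambda>n. x n - z n) 0 sequentially"
      using \<open>I_SP\<close> zI by (simp add: I_SP_def schur_property_def lim_sub)
    from limitin_seminorm_topology_add[OF P this[unfolded \<tau>] z(2)[unfolded \<tau>]]
    show "limitin \<tau> x 0 sequentially" by (simp add: \<tau>)
  qed
  ultimately show ?thesis by blast
qed

end
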